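(* Let $X$ be a semi-reflexive real Hausdorff locally convex topological vector space, let $F\subset X$ be a convex set with $0\in\operatorname{int}(F)$, and let $\Omega$ be a nonempty, convex, closed and bounded subset of $X$. Then for any $\bar x\in X$ the generalized projection $$\Pi_F(\bar x;\Omega):=\{\omega\in\Omega\mid\mathcal{T}^F_{\Omega}(\bar x)=\rho_F(\omega-\bar x)\}$$ is nonempty, and for any $\bar\omega\in\Pi_F(\bar x;\Omega)$ we have $$\partial\mathcal{T}^F_{\Omega}(\bar x)=\big(-\partial\rho_F(\bar\omega-\bar x)\big)\cap N(\bar\omega;\Omega).$$
   Context: A Hausdorff locally convex space is semi-reflexive if the canonical map into its bidual is surjective. $X^*$ is the topological dual of $X$, with pairing $\langle x^*,x\rangle=x^*(x)$. A set $A\subset X$ is bounded if for every neighborhood $V$ of the origin there is $t>0$ with $A\subset tV$. The minimal time function with target $\Omega$ and dynamics $F$ is $\mathcal{T}_{\Omega}^F(x):=\inf\{t>0\mid (x+tF)\cap\Omega\neq\emptyset\}$, $x\in X$. The Minkowski gauge is $\rho_F(x):=\inf\{t>0\mid x\in tF\}$. For a convex set $A\subset X$ and $\bar x\in A$, the normal cone is $N(\bar x;A):=\{x^*\in X^*\mid \langle x^*,x-\bar x\rangle\le 0\text{ for all }x\in A\}$. For a convex function $\varphi:X\to(-\infty,\infty]$ and $\bar x$ with $\varphi(\bar x)<\infty$, $\partial\varphi(\bar x):=\{x^*\in X^*\mid\langle x^*,x-\bar x\rangle\le\varphi(x)-\varphi(\bar x)\text{ for all }x\in X\}$. *)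

theory Defs
  imports "HOL-Analysis.Analysis"
begin

section \<open>Hausdorff locally convex spaces\<close>

text \<open>Convexity of \<open>V\<close> is spelled out because \<^const>\<open>convex\<close> is not available inside a class
  specification; see \<open>locally_convex_nhd\<close> below.\<close>

class hausdorff_lcs = real_vector + topological_ab_group_add + t2_space +
  assumes tendsto_scaleR_nhds:
    "((\<lambda>p. fst p *\<^sub>R snd p) \<longlongrightarrow> c *\<^sub>R x) (nhds (c :: real) \<times>\<^sub>F nhds x)"
  assumes locally_convex:
    "open U \<Longrightarrow> 0 \<in> U \<Longrightarrow>
      \<exists>V. open V \<and> 0 \<in> V \<and> V \<subseteq> U \<and>
        (\<forall>x\<in>V. \<forall>y\<in>V. \<forall>u\<ge>0. \<forall>v\<ge>0. u + v = 1 \<longrightarrow> u *\<^sub>R x + v *\<^sub>R y \<in> V)"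

lemma locally_convex_nhd:
  fixes U :: "'a::hausdorff_lcs set"
  assumes "open U" "0 \<in> U"
  obtains V where "open V" "0 \<in> V" "V \<subseteq> U" "convex V"
  using locally_convex[OF assms] unfolding convex_def by blast

instance real_normed_vector \<subseteq> hausdorff_lcs
proof
  fix c :: real and x :: 'a
  show "((\<lambda>p. fst p *\<^sub>R snd p) \<longlongrightarrow> c *\<^sub>R x) (nhds c \<times>\<^sub>F nhds x)"
    by (intro tendsto_intros filterlim_fst filterlim_snd)
next
  fix U :: "'a set" assume "open U" "0 \<in> U"
  then obtain e where "e > 0" "ball 0 e \<subseteq> U"
    using openE by blast
  moreover have "convex (ball (0 :: 'a) e)"
    by (rule convex_ball)
  ultimately show "\<exists>V. open V \<and> 0 \<in> V \<and> V \<subseteq> U \<and>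
        (\<forall>x\<in>V. \<forall>y\<in>V. \<forall>u\<ge>0. \<forall>v\<ge>0. u + v = 1 \<longrightarrow> u *\<^sub>R x + v *\<^sub>R y \<in> V)"
    by (intro exI[of _ "ball 0 e"]) (auto simp: convex_def)
qed

lemma scaleR_nhdsE:
  fixes x :: "'a::hausdorff_lcs"
  assumes "open V" "c *\<^sub>R x \<in> V"
  obtains d W where "d > 0" "open W" "x \<in> W" "\<And>r w. \<bar>r - c\<bar> < d \<Longrightarrow> w \<in> W \<Longrightarrow> r *\<^sub>R w \<in> V"
proof -
  have "eventually (\<lambda>p. fst p *\<^sub>R snd p \<in> V) (nhds c \<times>\<^sub>F nhds x)"
    using tendsto_scaleR_nhds[of c x] assms by (rule topological_tendstoD)
  then obtain P Q where P: "eventually P (nhds c)" and Q: "eventually Q (nhds x)"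
    and PQ: "\<And>r w. P r \<Longrightarrow> Q w \<Longrightarrow> r *\<^sub>R w \<in> V"
    unfolding eventually_prod_filter by auto
  obtain d where d: "d > 0" "\<And>r. dist r c < d \<Longrightarrow> P r"
    using P unfolding eventually_nhds_metric by blast
  obtain W where W: "open W" "x \<in> W" "\<And>w. w \<in> W \<Longrightarrow> Q w"
    using Q unfolding eventually_nhds by blast
  show ?thesis
    by (rule that[OF d(1) W(1,2)]) (use PQ d W in \<open>auto simp: dist_real_def\<close>)
qed

section \<open>Bounded sets\<close>

definition tvs_bounded :: "'a::hausdorff_lcs set \<Rightarrow> bool" where
  "tvs_bounded A \<longleftrightarrow> (\<forall>V. 0 \<in> interior V \<longrightarrow> (\<exists>t>0. A \<subseteq> (*\<^sub>R) t ` V))"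

lemma tvs_bounded_absorbed:
  fixes A :: "'a::hausdorff_lcs set"
  assumes "tvs_bounded A" "open V" "0 \<in> V"
  obtains s where "s > 0" "\<And>t. t \<ge> s \<Longrightarrow> A \<subseteq> (*\<^sub>R) t ` V"
proof -
  have "0 *\<^sub>R 0 \<in> V" using assms by simp
  then obtain d W where d: "d > 0" and W: "open W" "0 \<in> W"
    and dW: "\<And>r w. \<bar>r - 0\<bar> < d \<Longrightarrow> w \<in> W \<Longrightarrow> r *\<^sub>R w \<in> V"
    using scaleR_nhdsE[OF assms(2)] by metis
  have "0 \<in> interior W" using W by (simp add: interior_open)
  then obtain s where s: "s > 0" "A \<subseteq> (*\<^sub>R) s ` W"
    using assms(1) unfolding tvs_bounded_def by blast
  show ?thesis
  proof (rule that[of "2 * s / d"])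
    show "2 * s / d > 0" using s d by simp
    fix t assume t: "t \<ge> 2 * s / d"
    have tpos: "t > 0"
      using t s d by (smt (verit) divide_pos_pos)
    have "s / t < d"
      using t s d tpos by (simp add: field_simps)
    then have small: "\<bar>s / t - 0\<bar> < d" using s tpos by simp
    show "A \<subseteq> (*\<^sub>R) t ` V"
    proof
      fix a assume "a \<in> A"
      then obtain w where w: "w \<in> W" "a = s *\<^sub>R w" using s by blast
      have "a = t *\<^sub>R ((s / t) *\<^sub>R w)" using w tpos by simp
      then show "a \<in> (*\<^sub>R) t ` V" using dW[OF small w(1)] by blast
    qed
  qed
qed

lemma tvs_bounded_Un:
  assumes "tvs_bounded A" "tvs_bounded B"
  shows "tvs_bounded (A \<union> B)"
  unfolding tvs_bounded_def
proof (intro allI impI)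
  fix V :: "'a set" assume "0 \<in> interior V"
  then obtain a b where "a > 0" "b > 0"
    and "\<And>t. t \<ge> a \<Longrightarrow> A \<subseteq> (*\<^sub>R) t ` interior V" "\<And>t. t \<ge> b \<Longrightarrow> B \<subseteq> (*\<^sub>R) t ` interior V"
    using tvs_bounded_absorbed assms open_interior by metis
  then have "A \<union> B \<subseteq> (*\<^sub>R) (max a b) ` interior V" "max a b > 0"
    by auto
  then show "\<exists>t>0. A \<union> B \<subseteq> (*\<^sub>R) t ` V"
    using interior_subset[of V] by (meson image_mono order_trans)
qed

lemma tvs_bounded_singleton: "tvs_bounded {x}"
  unfolding tvs_bounded_def
proof (intro allI impI)
  fix V :: "'a set" assume "0 \<in> interior V"
  then have "0 *\<^sub>R x \<in> interior V" by simp
  then obtain d W where d: "d > 0" and "x \<in> W"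
    and dW: "\<And>r w. \<bar>r - 0\<bar> < d \<Longrightarrow> w \<in> W \<Longrightarrow> r *\<^sub>R w \<in> interior V"
    using scaleR_nhdsE[OF open_interior] by metis
  then have "(d / 2) *\<^sub>R x \<in> V"
    using dW[of "d / 2" x] interior_subset[of V] by auto
  moreover have "x = (2 / d) *\<^sub>R ((d / 2) *\<^sub>R x)" using d by simp
  ultimately show "\<exists>t>0. {x} \<subseteq> (*\<^sub>R) t ` V"
    using d by (intro exI[of _ "2 / d"]) (auto intro: image_eqI[of _ _ "(d / 2) *\<^sub>R x"])
qed

section \<open>The topological dual with its strong topology\<close>

typedef (overloaded) 'a dual =
  "{f :: 'a::hausdorff_lcs \<Rightarrow> real. linear f \<and> continuous_on UNIV f}"
  morphisms dual_apply Abs_dual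
  by (intro exI[of _ "\<lambda>_. 0"]) (auto simp: linear_iff)

setup_lifting type_definition_dual

lemma linear_dual_apply: "linear (dual_apply f)"
  and continuous_on_dual_apply: "continuous_on UNIV (dual_apply f)"
  using dual_apply[of f] by auto

lemma dual_eqI: "(\<And>x. dual_apply f x = dual_apply g x) \<Longrightarrow> f = g"
  by (meson dual_apply_inject ext)

instantiation dual :: (hausdorff_lcs) real_vector
begin

lift_definition zero_dual :: "'a dual" is "\<lambda>_. 0"
  by (auto simp: linear_iff)

lift_definition plus_dual :: "'a dual \<Rightarrow> 'a dual \<Rightarrow> 'a dual" is "\<lambda>f g x. f x + g x"
  by (auto simp: linear_iff algebra_simps intro!: continuous_intros)

lift_definition minus_dual :: "'a dual \<Rightarrow> 'a dual \<Rightarrow> 'a dual" is "\<lambda>f g x. f x - g x"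
  by (auto simp: linear_iff algebra_simps intro!: continuous_intros)

lift_definition uminus_dual :: "'a dual \<Rightarrow> 'a dual" is "\<lambda>f x. - f x"
  by (auto simp: linear_iff algebra_simps intro!: continuous_intros)

lift_definition scaleR_dual :: "real \<Rightarrow> 'a dual \<Rightarrow> 'a dual" is "\<lambda>r f x. r * f x"
  by (auto simp: linear_iff algebra_simps intro!: continuous_intros)

instance
  by standard (transfer; auto simp: algebra_simps)+

end

lemmas dual_apply_simps [simp] =
  zero_dual.rep_eq plus_dual.rep_eq minus_dual.rep_eq uminus_dual.rep_eq scaleR_dual.rep_eq

lemma dual_bounded_on:
  assumes "tvs_bounded B"
  obtains M where "M > 0" "\<And>x. x \<in> B \<Longrightarrow> \<bar>dual_apply f x\<bar> < M"
proof -
  have "open (dual_apply f -` {-1<..<1})"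
    using continuous_on_dual_apply by (intro open_vimage) auto
  moreover have "0 \<in> dual_apply f -` {-1<..<1}"
    using linear_0[OF linear_dual_apply[of f]] by auto
  ultimately obtain s where s: "s > 0" "B \<subseteq> (*\<^sub>R) s ` (dual_apply f -` {-1<..<1})"
    using tvs_bounded_absorbed[OF assms] by (metis order_refl)
  show ?thesis
  proof (rule that[OF s(1)])
    fix x assume "x \<in> B"
    then obtain y where "x = s *\<^sub>R y" "y \<in> dual_apply f -` {-1<..<1}" using s by blast
    then have y: "x = s *\<^sub>R y" "\<bar>dual_apply f y\<bar> < 1" by auto
    have "dual_apply f x = s * dual_apply f y"
      by (simp add: y linear_scale[OF linear_dual_apply])
    then show "\<bar>dual_apply f x\<bar> < s"
      using y s by (simp add: abs_mult)
  qed
qed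

definition dual_nhd :: "'a::hausdorff_lcs dual \<Rightarrow> 'a set \<Rightarrow> real \<Rightarrow> 'a dual set" where
  "dual_nhd f B e = {g. \<exists>e'<e. \<forall>x\<in>B. \<bar>dual_apply g x - dual_apply f x\<bar> \<le> e'}"

lemma dual_nhd_antimono:
  "B \<subseteq> C \<Longrightarrow> d \<le> e \<Longrightarrow> dual_nhd f C d \<subseteq> dual_nhd f B e"
  unfolding dual_nhd_def by (force intro: less_le_trans)

lemma dual_nhd_self: "e > 0 \<Longrightarrow> f \<in> dual_nhd f B e"
  unfolding dual_nhd_def by auto

lemma dual_nhdD:
  "g \<in> dual_nhd f B e \<Longrightarrow> x \<in> B \<Longrightarrow> \<bar>dual_apply g x - dual_apply f x\<bar> < e"
  unfolding dual_nhd_def by force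

lemma dual_nhdI:
  "e' < e \<Longrightarrow> (\<And>x. x \<in> B \<Longrightarrow> \<bar>dual_apply g x - dual_apply f x\<bar> \<le> e') \<Longrightarrow> g \<in> dual_nhd f B e"
  unfolding dual_nhd_def by blast

text \<open>The strong topology, i.e. uniform convergence on bounded sets.  The functionals
  \<open>g\<close> with \<open>sup\<^bsub>B\<^esub> \<bar>g - f\<bar> < e\<close>, for bounded \<open>B\<close> and \<open>e > 0\<close>, form a neighbourhood base at \<open>f\<close>;
  \<open>dual_nhd\<close> avoids the supremum, which is unspecified for \<open>B = {}\<close>.\<close>

instantiation dual :: (hausdorff_lcs) topological_space
begin

definition open_dual :: "'a dual set \<Rightarrow> bool" where
  "open_dual U \<longleftrightarrow> (\<forall>f\<in>U. \<exists>B e. tvs_bounded B \<and> e > 0 \<and> dual_nhd f B e \<subseteq> U)"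

instance
proof
  show "open (UNIV :: 'a dual set)"
    unfolding open_dual_def using tvs_bounded_singleton zero_less_one by blast
next
  fix S T :: "'a dual set" assume ST: "open S" "open T"
  show "open (S \<inter> T)"
    unfolding open_dual_def
  proof
    fix f assume "f \<in> S \<inter> T"
    then obtain B d C e where B: "tvs_bounded B" "d > 0" "dual_nhd f B d \<subseteq> S"
      and C: "tvs_bounded C" "e > 0" "dual_nhd f C e \<subseteq> T"
      using ST unfolding open_dual_def by (meson IntE)
    have "dual_nhd f (B \<union> C) (min d e) \<subseteq> S \<inter> T"
      using dual_nhd_antimono[of B "B \<union> C" "min d e" d f]
        dual_nhd_antimono[of C "B \<union> C" "min d e" e f] B C by auto
    then show "\<exists>B e. tvs_bounded B \<and> e > 0 \<and> dual_nhd f B e \<subseteq> S \<inter> T"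
      using tvs_bounded_Un[OF B(1) C(1)] B(2) C(2) by (metis min_less_iff_conj)
  qed
next
  fix K :: "'a dual set set" assume "\<forall>S\<in>K. open S"
  then show "open (\<Union>K)"
    unfolding open_dual_def by (meson UnionE Union_upper order_trans)
qed

end

lemma open_dual_nhd:
  assumes "tvs_bounded B"
  shows "open (dual_nhd f B e)"
  unfolding open_dual_def
proof
  fix g assume "g \<in> dual_nhd f B e"
  then obtain e' where e': "e' < e" "\<forall>x\<in>B. \<bar>dual_apply g x - dual_apply f x\<bar> \<le> e'"
    unfolding dual_nhd_def by blast
  have "dual_nhd g B (e - e') \<subseteq> dual_nhd f B e"
  proof
    fix h assume "h \<in> dual_nhd g B (e - e')"
    then obtain d where d: "d < e - e'" "\<forall>x\<in>B. \<bar>dual_apply h x - dual_apply g x\<bar> \<le> d"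
      unfolding dual_nhd_def by blast
    show "h \<in> dual_nhd f B e"
    proof (rule dual_nhdI)
      show "e' + d < e" using d by simp
      show "\<bar>dual_apply h x - dual_apply f x\<bar> \<le> e' + d" if "x \<in> B" for x
        using d(2) e'(2) that by fastforce
    qed
  qed
  then show "\<exists>B' e'. tvs_bounded B' \<and> e' > 0 \<and> dual_nhd g B' e' \<subseteq> dual_nhd f B e"
    using assms e'(1) by (intro exI[of _ B] exI[of _ "e - e'"]) simp
qed

lemma eventually_nhds_dual:
  "eventually P (nhds f) \<longleftrightarrow>
    (\<exists>B e. tvs_bounded B \<and> e > 0 \<and> (\<forall>g \<in> dual_nhd f B e. P g))"
proof
  assume "eventually P (nhds f)"
  then obtain S where S: "open S" "f \<in> S" "\<forall>g\<in>S. P g" unfolding eventually_nhds by blast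
  then obtain B e where "tvs_bounded B" "e > 0" "dual_nhd f B e \<subseteq> S"
    unfolding open_dual_def by blast
  then show "\<exists>B e. tvs_bounded B \<and> e > 0 \<and> (\<forall>g \<in> dual_nhd f B e. P g)"
    using S(3) by (intro exI[of _ B] exI[of _ e]) auto
next
  assume "\<exists>B e. tvs_bounded B \<and> e > 0 \<and> (\<forall>g \<in> dual_nhd f B e. P g)"
  then obtain B e where B: "tvs_bounded B" "e > 0" "\<forall>g \<in> dual_nhd f B e. P g"
    by blast
  show "eventually P (nhds f)"
    unfolding eventually_nhds
    by (rule exI[of _ "dual_nhd f B e"]) (simp add: B open_dual_nhd dual_nhd_self)
qed

lemma eventually_dual_nhd:
  "tvs_bounded B \<Longrightarrow> e > 0 \<Longrightarrow> eventually (\<lambda>g. g \<in> dual_nhd f B e) (nhds f)"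
  unfolding eventually_nhds_dual by (intro exI[of _ B] exI[of _ e]) simp

lemma tendsto_dualI:
  assumes "\<And>B e. tvs_bounded B \<Longrightarrow> e > 0 \<Longrightarrow> eventually (\<lambda>z. h z \<in> dual_nhd f B e) F"
  shows "(h \<longlongrightarrow> f) F"
proof (rule topological_tendstoI)
  fix S assume "open S" "f \<in> S"
  then obtain B e where B: "tvs_bounded B" "e > 0" "dual_nhd f B e \<subseteq> S"
    unfolding open_dual_def by blast
  show "eventually (\<lambda>z. h z \<in> S) F"
    using assms[OF B(1,2)] by eventually_elim (use B in blast)
qed

instance dual :: (hausdorff_lcs) hausdorff_lcs
proof
  fix f g :: "'a dual"
  show "((\<lambda>p. fst p + snd p) \<longlongrightarrow> f + g) (nhds f \<times>\<^sub>F nhds g)"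
  proof (rule tendsto_dualI)
    fix B :: "'a set" and e :: real assume B: "tvs_bounded B" "e > 0"
    have "fst p + snd p \<in> dual_nhd (f + g) B e"
      if "fst p \<in> dual_nhd f B (e/3)" "snd p \<in> dual_nhd g B (e/3)" for p
    proof (rule dual_nhdI[of "2 * e / 3"])
      fix x assume "x \<in> B"
      then show "\<bar>dual_apply (fst p + snd p) x - dual_apply (f + g) x\<bar> \<le> 2 * e / 3"
        using dual_nhdD[OF that(1), of x] dual_nhdD[OF that(2), of x] unfolding dual_apply_simps by linarith
    qed (use B in simp)
    moreover have "eventually (\<lambda>p. fst p \<in> dual_nhd f B (e/3) \<and> snd p \<in> dual_nhd g B (e/3))
        (nhds f \<times>\<^sub>F nhds g)"
      unfolding eventually_prod_filter
      by (rule exI[of _ "\<lambda>h. h \<in> dual_nhd f B (e/3)"], rule exI[of _ "\<lambda>h. h \<in> dual_nhd g B (e/3)"])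
        (use B in \<open>auto intro!: eventually_dual_nhd\<close>)
    ultimately show "eventually (\<lambda>p. fst p + snd p \<in> dual_nhd (f + g) B e) (nhds f \<times>\<^sub>F nhds g)"
      by (auto elim: eventually_mono)
  qed
  show "(uminus \<longlongrightarrow> - f) (nhds f)"
  proof (rule tendsto_dualI)
    fix B :: "'a set" and e :: real assume B: "tvs_bounded B" "e > 0"
    have "- h \<in> dual_nhd (- f) B e" if "h \<in> dual_nhd f B e" for h
    proof -
      have *: "\<bar>- u - - v\<bar> = \<bar>u - v\<bar>" for u v :: real by linarith
      show ?thesis using that unfolding dual_nhd_def by (simp only: * mem_Collect_eq dual_apply_simps)
    qed
    then show "eventually (\<lambda>h. - h \<in> dual_nhd (- f) B e) (nhds f)"
      by (rule eventually_mono[OF eventually_dual_nhd[OF B]])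
  qed
next
  fix f g :: "'a dual" assume "f \<noteq> g"
  then obtain x where x: "dual_apply f x \<noteq> dual_apply g x"
    using dual_eqI by blast
  define e where "e = \<bar>dual_apply f x - dual_apply g x\<bar> / 2"
  have "e > 0" using x by (simp add: e_def)
  moreover have "dual_nhd f {x} e \<inter> dual_nhd g {x} e = {}"
  proof (rule ccontr)
    assume "dual_nhd f {x} e \<inter> dual_nhd g {x} e \<noteq> {}"
    then obtain h where "h \<in> dual_nhd f {x} e" "h \<in> dual_nhd g {x} e" by blast
    then have "\<bar>dual_apply h x - dual_apply f x\<bar> < e" "\<bar>dual_apply h x - dual_apply g x\<bar> < e"
      by (auto dest: dual_nhdD)
    moreover have "\<bar>dual_apply f x - dual_apply g x\<bar> = 2 * e" by (simp add: e_def)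
    ultimately show False by (smt (verit))
  qed
  ultimately show "\<exists>U V. open U \<and> open V \<and> f \<in> U \<and> g \<in> V \<and> U \<inter> V = {}"
    using open_dual_nhd[OF tvs_bounded_singleton] dual_nhd_self by meson
next
  fix c :: real and f :: "'a dual"
  show "((\<lambda>p. fst p *\<^sub>R snd p) \<longlongrightarrow> c *\<^sub>R f) (nhds c \<times>\<^sub>F nhds f)"
  proof (rule tendsto_dualI)
    fix B :: "'a set" and e :: real assume B: "tvs_bounded B" "e > 0"
    obtain M where M: "M > 0" "\<And>x. x \<in> B \<Longrightarrow> \<bar>dual_apply f x\<bar> < M"
      using dual_bounded_on[OF B(1)] by blast
    define d where "d = min 1 (e / (3 * M))"
    define K where "K = \<bar>c\<bar> + 1"
    define \<epsilon> where "\<epsilon> = (e / 3) / K"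
    have d: "d > 0" "d \<le> 1" using M B by (auto simp: d_def)
    have "d \<le> e / (3 * M)" by (simp add: d_def)
    then have dM: "d * M \<le> e / 3" using M(1) by (simp add: field_simps)
    have "K > 0" by (simp add: K_def)
    then have \<epsilon>: "\<epsilon> > 0" "K * \<epsilon> = e / 3"
      using B by (simp_all add: \<epsilon>_def)
    have *: "fst p *\<^sub>R snd p \<in> dual_nhd (c *\<^sub>R f) B e"
      if p: "dist (fst p) c < d" "snd p \<in> dual_nhd f B \<epsilon>" for p
    proof (rule dual_nhdI[of "2 * e / 3"])
      fix x assume x: "x \<in> B"
      let ?r = "fst p" and ?h = "dual_apply (snd p) x" and ?f = "dual_apply f x"
      have h: "\<bar>?h - ?f\<bar> \<le> \<epsilon>" using dual_nhdD[OF p(2) x] by simp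
      have r: "\<bar>?r - c\<bar> \<le> d" "\<bar>?r\<bar> \<le> K" using p(1) d by (auto simp: dist_real_def K_def)
      have "\<bar>?r * ?h - c * ?f\<bar> = \<bar>?r * (?h - ?f) + (?r - c) * ?f\<bar>"
        by (simp add: algebra_simps)
      also have "\<dots> \<le> \<bar>?r\<bar> * \<bar>?h - ?f\<bar> + \<bar>?r - c\<bar> * \<bar>?f\<bar>"
        by (metis abs_mult abs_triangle_ineq)
      also have "\<dots> \<le> K * \<epsilon> + d * M"
        using h r M(2)[OF x] d(1) \<open>K > 0\<close> by (intro add_mono mult_mono) auto
      also have "\<dots> \<le> 2 * e / 3" using dM \<epsilon>(2) by simp
      finally show "\<bar>dual_apply (?r *\<^sub>R snd p) x - dual_apply (c *\<^sub>R f) x\<bar> \<le> 2 * e / 3"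
        by simp
    qed (use B in simp)
    have "eventually (\<lambda>p. dist (fst p) c < d \<and> snd p \<in> dual_nhd f B \<epsilon>) (nhds c \<times>\<^sub>F nhds f)"
      unfolding eventually_prod_filter
      by (rule exI[of _ "\<lambda>r. dist r c < d"], rule exI[of _ "\<lambda>h. h \<in> dual_nhd f B \<epsilon>"])
        (use B d \<epsilon> in \<open>auto intro!: eventually_dual_nhd simp: eventually_nhds_metric\<close>)
    then show "eventually (\<lambda>p. fst p *\<^sub>R snd p \<in> dual_nhd (c *\<^sub>R f) B e) (nhds c \<times>\<^sub>F nhds f)"
      by (rule eventually_mono) (use * in blast)
  qed
next
  fix U :: "'a dual set" assume "open U" "0 \<in> U"
  then obtain B e where B: "tvs_bounded B" "e > 0" "dual_nhd 0 B e \<subseteq> U"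
    unfolding open_dual_def by blast
  have "u *\<^sub>R f + v *\<^sub>R g \<in> dual_nhd 0 B e"
    if fg: "f \<in> dual_nhd 0 B e" "g \<in> dual_nhd 0 B e" and uv: "u \<ge> 0" "v \<ge> 0" "u + v = 1"
    for f g u v
  proof -
    obtain a b where a: "a < e" "\<And>x. x \<in> B \<Longrightarrow> \<bar>dual_apply f x\<bar> \<le> a"
      and b: "b < e" "\<And>x. x \<in> B \<Longrightarrow> \<bar>dual_apply g x\<bar> \<le> b"
      using fg unfolding dual_nhd_def by auto
    show ?thesis
    proof (rule dual_nhdI[of "max a b"])
      show "max a b < e" using a b by simp
      fix x assume x: "x \<in> B"
      have "\<bar>u * dual_apply f x + v * dual_apply g x\<bar> \<le> u * \<bar>dual_apply f x\<bar> + v * \<bar>dual_apply g x\<bar>"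
        using uv by (metis abs_mult abs_of_nonneg abs_triangle_ineq)
      also have "\<dots> \<le> u * max a b + v * max a b"
        using a(2)[OF x] b(2)[OF x] uv by (intro add_mono mult_left_mono) auto
      also have "\<dots> = max a b" using uv by (metis distrib_right mult_1)
      finally show "\<bar>dual_apply (u *\<^sub>R f + v *\<^sub>R g) x - dual_apply 0 x\<bar> \<le> max a b"
        by simp
    qed
  qed
  then show "\<exists>V. open V \<and> 0 \<in> V \<and> V \<subseteq> U \<and>
        (\<forall>x\<in>V. \<forall>y\<in>V. \<forall>u\<ge>0. \<forall>v\<ge>0. u + v = 1 \<longrightarrow> u *\<^sub>R x + v *\<^sub>R y \<in> V)"
    using B open_dual_nhd dual_nhd_self by (intro exI[of _ "dual_nhd 0 B e"]) auto
qed

section \<open>Semi-reflexivity\<close>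

lift_definition bidual_embedding :: "'a::hausdorff_lcs \<Rightarrow> 'a dual dual" is
  "\<lambda>x f. dual_apply f x"
proof
  fix x :: 'a
  show "linear (\<lambda>f. dual_apply f x)" by (simp add: linear_iff)
  have "((\<lambda>f. dual_apply f x) \<longlongrightarrow> dual_apply f x) (nhds f)" for f
  proof (rule tendstoI)
    fix e :: real assume "e > 0"
    then show "eventually (\<lambda>g. dist (dual_apply g x) (dual_apply f x) < e) (nhds f)"
      using eventually_dual_nhd[OF tvs_bounded_singleton[of x], of e f]
      by (auto elim!: eventually_mono dest: dual_nhdD simp: dist_real_def)
  qed
  then show "continuous_on UNIV (\<lambda>f. dual_apply f x)"
    unfolding continuous_on_def using tendsto_mono[OF at_within_le_nhds] by blast
qed

definition semi_reflexive :: "'a::hausdorff_lcs itself \<Rightarrow> bool" where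
  "semi_reflexive X \<longleftrightarrow> surj (bidual_embedding :: 'a \<Rightarrow> 'a dual dual)"

section \<open>Minimal time function, gauge, normal cone, subdifferential\<close>

text \<open>Infima are taken in \<^typ>\<open>ereal\<close>, so the infimum of the empty set is \<open>\<infinity>\<close>.\<close>

definition minimal_time :: "'a::hausdorff_lcs set \<Rightarrow> 'a set \<Rightarrow> 'a \<Rightarrow> ereal" where
  "minimal_time F \<Omega> x = Inf {ereal t | t. t > 0 \<and> ((+) x ` (*\<^sub>R) t ` F) \<inter> \<Omega> \<noteq> {}}"

definition gauge_fun :: "'a::hausdorff_lcs set \<Rightarrow> 'a \<Rightarrow> ereal" where
  "gauge_fun F x = Inf {ereal t | t. t > 0 \<and> x \<in> (*\<^sub>R) t ` F}"

definition normal_cone :: "'a::hausdorff_lcs \<Rightarrow> 'a set \<Rightarrow> 'a dual set" where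
  "normal_cone a A = {f. \<forall>x\<in>A. dual_apply f (x - a) \<le> 0}"

text \<open>Meaningful only for convex \<open>\<phi>\<close> with \<open>-\<infinity> < \<phi>\<close> and \<open>\<phi> a < \<infinity>\<close>.\<close>

definition subdifferential :: "('a::hausdorff_lcs \<Rightarrow> ereal) \<Rightarrow> 'a \<Rightarrow> 'a dual set" where
  "subdifferential \<phi> a = {f. \<forall>x. ereal (dual_apply f (x - a)) \<le> \<phi> x - \<phi> a}"

definition generalized_projection :: "'a::hausdorff_lcs set \<Rightarrow> 'a \<Rightarrow> 'a set \<Rightarrow> 'a set" where
  "generalized_projection F x \<Omega> = {\<omega> \<in> \<Omega>. minimal_time F \<Omega> x = gauge_fun F (\<omega> - x)}"

end

theory Submission
  imports Defs
begin

text \<open>Since \<open>0\<close> is interior to \<open>F\<close>, the gauge \<open>p\<close> of \<open>F\<close> is real-valued and sublinear, and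
  \<open>\<T>(x) = inf\<^bsub>\<omega>\<in>\<Omega>\<^esub> p(\<omega> - x)\<close>; the subdifferential formula follows by substituting
  suitable points into the subgradient inequalities.  For the existence of a projection, let \<open>m = \<T>(x)\<close>,
  let \<open>q(f)\<close> be the infimum over \<open>t > m\<close> of the suprema of \<open>f\<close> on the sets
  \<open>{\<omega> \<in> \<Omega>. p(\<omega> - x) \<le> t}\<close>, and use the Hahn-Banach theorem on the dual
  to find a linear \<open>\<Phi> \<le> q\<close>.  As \<open>\<Omega>\<close> is bounded, \<open>\<Phi>\<close> is strongly continuous, so
  semi-reflexivity represents it by a point \<open>w\<close>.  Then \<open>w \<in> \<Omega>\<close> by separation, and
  \<open>p(w - x) \<le> m\<close> by testing with a functional dominated by \<open>p\<close> and supporting it at \<open>w - x\<close>.\<close>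

section \<open>The Hahn-Banach theorem\<close>

text \<open>Homogeneity is stated as an inequality for \<open>c > 0\<close>; applying it to
  \<open>inverse c\<close> turns it into an equality, and \<open>c = 2\<close> at the origin gives
  \<open>q 0 = 0\<close>.\<close>

definition sublinear :: "('a::real_vector \<Rightarrow> real) \<Rightarrow> bool" where
  "sublinear q \<longleftrightarrow> (\<forall>x y. q (x + y) \<le> q x + q y) \<and> (\<forall>c>0. \<forall>x. q (c *\<^sub>R x) \<le> c * q x)"

lemma sublinear_add: "sublinear q \<Longrightarrow> q (x + y) \<le> q x + q y"
  by (simp add: sublinear_def)

lemma sublinear_scaleR:
  assumes "sublinear q" "c > 0"
  shows "q (c *\<^sub>R x) = c * q x"
proof (rule antisym)
  show "q (c *\<^sub>R x) \<le> c * q x" using assms by (simp add: sublinear_def)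
  have "q (inverse c *\<^sub>R (c *\<^sub>R x)) \<le> inverse c * q (c *\<^sub>R x)"
    using assms unfolding sublinear_def by (meson positive_imp_inverse_positive)
  then show "c * q x \<le> q (c *\<^sub>R x)"
    using assms by (simp add: field_simps)
qed

lemma sublinear_0: "sublinear q \<Longrightarrow> q 0 = 0"
  using sublinear_scaleR[of q 2 0] by simp

lemma sublinear_uminus: "sublinear q \<Longrightarrow> - q (- x) \<le> q x"
  using sublinear_add[of q x "- x"] sublinear_0[of q] by simp

text \<open>Shared criterion for four constructions: the lowered functional, the infimum of a chain,
  the gauge, and the functional on the dual.\<close>

lemma sublinear_Inf:
  fixes A :: "'a::real_vector \<Rightarrow> real set"
  assumes ne: "\<And>x. A x \<noteq> {}" and bdd: "\<And>x. bdd_below (A x)"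
    and add: "\<And>x y a b. a \<in> A x \<Longrightarrow> b \<in> A y \<Longrightarrow> \<exists>c\<in>A (x + y). c \<le> a + b"
    and scale: "\<And>x a c. c > 0 \<Longrightarrow> a \<in> A x \<Longrightarrow> c * a \<in> A (c *\<^sub>R x)"
  shows "sublinear (\<lambda>x. Inf (A x))"
  unfolding sublinear_def
proof (intro conjI allI impI)
  fix x y
  have "Inf (A (x + y)) - b \<le> Inf (A x)" if b: "b \<in> A y" for b
  proof (rule cInf_greatest[OF ne])
    fix a assume "a \<in> A x"
    then obtain c where "c \<in> A (x + y)" "c \<le> a + b" using add b by blast
    then show "Inf (A (x + y)) - b \<le> a"
      using cInf_lower[OF _ bdd] by (smt (verit))
  qed
  then have "Inf (A (x + y)) - Inf (A x) \<le> Inf (A y)"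
    by (intro cInf_greatest[OF ne]) (smt (verit))
  then show "Inf (A (x + y)) \<le> Inf (A x) + Inf (A y)" by simp
next
  fix c :: real and x assume c: "c > 0"
  have "Inf (A (c *\<^sub>R x)) / c \<le> Inf (A x)"
  proof (rule cInf_greatest[OF ne])
    fix a assume "a \<in> A x"
    then have "Inf (A (c *\<^sub>R x)) \<le> c * a"
      using scale[OF c] bdd by (intro cInf_lower)
    then show "Inf (A (c *\<^sub>R x)) / c \<le> a" using c by (simp add: field_simps)
  qed
  then show "Inf (A (c *\<^sub>R x)) \<le> c * Inf (A x)" using c by (simp add: field_simps)
qed

text \<open>Lowering \<open>q\<close> so that it becomes odd along \<open>x\<^sub>0\<close>: a sublinear functional minimal in the
  pointwise order therefore is linear.\<close>

lemma sublinear_lower: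
  assumes q: "sublinear q"
  obtains r where "sublinear r" "r \<le> q" "r (- x\<^sub>0) \<le> - q x\<^sub>0"
proof -
  \<comment> \<open>Taking \<open>t = 0\<close> puts \<open>q x\<close> into \<open>A x\<close>, so
    the infimum lies below \<open>q\<close>; taking \<open>t = 1\<close> at
    \<open>- x\<^sub>0\<close> yields the value \<open>- q x\<^sub>0\<close>.\<close>
  define A where "A x = {q (x + t *\<^sub>R x\<^sub>0) - t * q x\<^sub>0 | t. t \<ge> 0}" for x
  have q': "q (t *\<^sub>R x) = t * q x" if "t \<ge> 0" for t x
    using sublinear_scaleR[OF q, of t x] sublinear_0[OF q] that by (cases "t = 0") auto
  have bdd: "bdd_below (A x)" for x
  proof (rule bdd_belowI[of _ "- q (- x)"])
    fix a assume "a \<in> A x"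
    then obtain t where t: "t \<ge> 0" "a = q (x + t *\<^sub>R x\<^sub>0) - t * q x\<^sub>0" by (auto simp: A_def)
    have "q (t *\<^sub>R x\<^sub>0) \<le> q (x + t *\<^sub>R x\<^sub>0) + q (- x)"
      using sublinear_add[OF q, of "x + t *\<^sub>R x\<^sub>0" "- x"] by simp
    then show "- q (- x) \<le> a" using t q' by simp
  qed
  show ?thesis
  proof (rule that[of "\<lambda>x. Inf (A x)"])
    show "sublinear (\<lambda>x. Inf (A x))"
    proof (rule sublinear_Inf[OF _ bdd])
      show "A x \<noteq> {}" for x by (auto simp: A_def)
      show "\<exists>c\<in>A (x + y). c \<le> a + b" if ab: "a \<in> A x" "b \<in> A y" for x y a b
      proof -
        obtain s t where st: "s \<ge> 0" "a = q (x + s *\<^sub>R x\<^sub>0) - s * q x\<^sub>0"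
          "t \<ge> 0" "b = q (y + t *\<^sub>R x\<^sub>0) - t * q x\<^sub>0" using ab by (auto simp: A_def)
        have "q (x + y + (s + t) *\<^sub>R x\<^sub>0) \<le> q (x + s *\<^sub>R x\<^sub>0) + q (y + t *\<^sub>R x\<^sub>0)"
          using sublinear_add[OF q, of "x + s *\<^sub>R x\<^sub>0" "y + t *\<^sub>R x\<^sub>0"] by (simp add: algebra_simps)
        then show ?thesis using st
          by (intro bexI[of _ "q (x + y + (s + t) *\<^sub>R x\<^sub>0) - (s + t) * q x\<^sub>0"])
            (auto simp: A_def algebra_simps intro!: exI[of _ "s + t"])
      qed
      show "c * a \<in> A (c *\<^sub>R x)" if c: "c > 0" and a: "a \<in> A x" for x a c
      proof -
        obtain t where t: "t \<ge> 0" "a = q (x + t *\<^sub>R x\<^sub>0) - t * q x\<^sub>0" using a by (auto simp: A_def)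
        have "q (c *\<^sub>R x + (c * t) *\<^sub>R x\<^sub>0) = c * q (x + t *\<^sub>R x\<^sub>0)"
          using sublinear_scaleR[OF q c, of "x + t *\<^sub>R x\<^sub>0"] by (simp add: scaleR_add_right)
        then have "c * a = q (c *\<^sub>R x + (c * t) *\<^sub>R x\<^sub>0) - (c * t) * q x\<^sub>0"
          unfolding t(2) by (simp add: right_diff_distrib)
        then show ?thesis using c t unfolding A_def by (intro CollectI exI[of _ "c * t"]) simp
      qed
    qed
    show "(\<lambda>x. Inf (A x)) \<le> q"
    proof (rule le_funI)
      show "Inf (A x) \<le> q x" for x
        by (rule cInf_lower[OF _ bdd]) (auto simp: A_def intro!: exI[of _ 0])
    qed
    show "Inf (A (- x\<^sub>0)) \<le> - q x\<^sub>0"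
      by (rule cInf_lower[OF _ bdd]) (auto simp: A_def sublinear_0[OF q] intro!: exI[of _ 1])
  qed
qed

text \<open>Zorn's lemma for the reversed pointwise order. The pointwise infimum of a chain is a
  lower bound; it is finite since \<open>r x \<ge> - r (- x) \<ge> - q (- x)\<close>.\<close>

lemma sublinear_minimal:
  assumes q: "sublinear q"
  obtains m where "sublinear m" "m \<le> q" "\<And>r. sublinear r \<Longrightarrow> r \<le> m \<Longrightarrow> r = m"
proof -
  define S where "S = {r. sublinear r \<and> r \<le> q}"
  have "\<exists>m\<in>S. \<forall>r\<in>S. r \<le> m \<longrightarrow> r = m"
  proof (rule predicate_Zorn[where P = "\<lambda>r s. s \<le> r"])
    show "partial_order_on S (relation_of (\<lambda>r s. s \<le> r) S)"
      by (rule partial_order_on_relation_ofI) auto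
    fix C assume C: "C \<in> Chains (relation_of (\<lambda>r s. s \<le> r) S)"
    then have chain: "r \<le> s \<or> s \<le> r" if "r \<in> C" "s \<in> C" for r s
      using that by (auto simp: Chains_def relation_of_def)
    have CS: "C \<subseteq> S" using C by (auto simp: Chains_def relation_of_def)
    show "\<exists>u\<in>S. \<forall>r\<in>C. u \<le> r"
    proof (cases "C = {}")
      case True
      then show ?thesis using q by (auto simp: S_def)
    next
      case False
      define u where "u x = Inf ((\<lambda>r. r x) ` C)" for x
      have lin: "sublinear r" if "r \<in> C" for r using CS that by (auto simp: S_def)
      have bdd: "bdd_below ((\<lambda>r. r x) ` C)" for x
      proof (rule bdd_belowI2[of _ "- q (- x)"])
        fix r assume r: "r \<in> C"
        then have "r (- x) \<le> q (- x)" using CS by (auto simp: S_def le_fun_def)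
        then show "- q (- x) \<le> r x" using sublinear_uminus[OF lin[OF r], of x] by simp
      qed
      have low: "u \<le> r" if "r \<in> C" for r
        unfolding u_def using that by (intro le_funI cInf_lower bdd) auto
      have "sublinear u" unfolding u_def
      proof (rule sublinear_Inf[OF _ bdd])
        show "(\<lambda>r. r x) ` C \<noteq> {}" for x using False by simp
        show "\<exists>c\<in>(\<lambda>r. r (x + y)) ` C. c \<le> a + b"
          if ab: "a \<in> (\<lambda>r. r x) ` C" "b \<in> (\<lambda>r. r y) ` C" for x y a b
        proof -
          obtain r s where rs: "r \<in> C" "s \<in> C" "a = r x" "b = s y" using ab by auto
          \<comment> \<open>Subadditivity survives the infimum because in a chain one of
            \<open>r\<close>, \<open>s\<close> lies below both.\<close>
          obtain k where k: "k \<in> C" "k \<le> r" "k \<le> s" using chain[OF rs(1,2)] rs by blast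
          have "k (x + y) \<le> k x + k y" by (rule sublinear_add[OF lin[OF k(1)]])
          also have "\<dots> \<le> a + b" using k rs by (auto simp: le_fun_def intro: add_mono)
          finally show ?thesis using k by blast
        qed
        show "c * a \<in> (\<lambda>r. r (c *\<^sub>R x)) ` C" if "c > 0" "a \<in> (\<lambda>r. r x) ` C" for x a c
          using that sublinear_scaleR[OF lin] by force
      qed
      moreover have "u \<le> q" using False low CS by (force simp: S_def intro: order_trans)
      ultimately show ?thesis using low by (auto simp: S_def)
    qed
  qed
  then show ?thesis using that unfolding S_def by (blast intro: order_trans)
qed

text \<open>A minimal sublinear functional is odd, as lowering cannot change it, and an odd
  subadditive functional is additive. Lowering \<open>q\<close> along \<open>x\<^sub>0\<close>
  before minimising forces equality at \<open>x\<^sub>0\<close>.\<close>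

theorem hahn_banach:
  assumes q: "sublinear q"
  obtains f where "linear f" "f \<le> q" "f x\<^sub>0 = q x\<^sub>0"
proof -
  obtain r where r: "sublinear r" "r \<le> q" "r (- x\<^sub>0) \<le> - q x\<^sub>0"
    using sublinear_lower[OF q] .
  obtain f where f: "sublinear f" "f \<le> r" "\<And>s. sublinear s \<Longrightarrow> s \<le> f \<Longrightarrow> s = f"
    using sublinear_minimal[OF r(1)] by blast
  have neg: "f (- x) = - f x" for x
  proof -
    obtain s where "sublinear s" "s \<le> f" "s (- x) \<le> - f x" using sublinear_lower[OF f(1)] .
    then have "f (- x) \<le> - f x" using f(3) by auto
    then show ?thesis using sublinear_uminus[OF f(1), of x] by simp
  qed
  have add: "f (x + y) = f x + f y" for x y
    using sublinear_add[OF f(1), of x y] sublinear_add[OF f(1), of "- x" "- y"]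
      neg[of "x + y"] neg[of x] neg[of y] by simp
  have "f (c *\<^sub>R x) = c * f x" for c x
  proof (cases "c < 0")
    case True
    then show ?thesis using sublinear_scaleR[OF f(1), of "- c" x] neg[of "c *\<^sub>R x"] by simp
  next
    case False
    then show ?thesis
      using sublinear_scaleR[OF f(1), of c x] sublinear_0[OF f(1)] by (cases "c = 0") auto
  qed
  then have "linear f" using add by (intro linearI) auto
  moreover have "f \<le> q" using f(2) r(2) by (rule order_trans)
  moreover have "f x\<^sub>0 = q x\<^sub>0"
  proof (rule antisym)
    show "f x\<^sub>0 \<le> q x\<^sub>0" using \<open>f \<le> q\<close> by (rule le_funD)
    show "q x\<^sub>0 \<le> f x\<^sub>0" using le_funD[OF f(2), of "- x\<^sub>0"] r(3) neg[of x\<^sub>0] by simp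
  qed
  ultimately show ?thesis by (rule that)
qed

section \<open>Real-valued gauges and separation\<close>

lemma continuous_on_scaleR_hausdorff_lcs:
  "continuous_on UNIV ((*\<^sub>R) c :: 'a::hausdorff_lcs \<Rightarrow> 'a)"
  unfolding continuous_on_topological
proof (intro ballI allI impI)
  fix x :: 'a and V assume "open V" "c *\<^sub>R x \<in> V"
  then obtain d W where "d > 0" "open W" "x \<in> W"
    "\<And>r w. \<bar>r - c\<bar> < d \<Longrightarrow> w \<in> W \<Longrightarrow> r *\<^sub>R w \<in> V" using scaleR_nhdsE by metis
  then show "\<exists>W. open W \<and> x \<in> W \<and> (\<forall>y\<in>UNIV. y \<in> W \<longrightarrow> c *\<^sub>R y \<in> V)"
    by (intro exI[of _ W]) auto
qed

text \<open>Scaling makes the one-sided bound on \<open>V\<close> small, and applying it to both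
  \<open>y - x\<close> and \<open>x - y\<close> makes it two-sided.\<close>

lemma linear_continuous_hausdorff_lcs:
  fixes f :: "'a::hausdorff_lcs \<Rightarrow> real"
  assumes f: "linear f" and V: "open V" "0 \<in> V" "\<And>v. v \<in> V \<Longrightarrow> f v \<le> 1"
  shows "continuous_on UNIV f"
  unfolding continuous_on_topological
proof (intro ballI allI impI)
  fix x :: 'a and B assume "open B" "f x \<in> B"
  then obtain e where e: "e > 0" "\<And>y. dist y (f x) < e \<Longrightarrow> y \<in> B"
    unfolding open_dist by blast
  \<comment> \<open>The factor 2 makes \<open>1 / k\<close> strictly smaller than \<open>e\<close>,
    since the bound on \<open>V\<close> is not strict.\<close>
  define k where "k = 2 / e"
  have k: "k > 0" "1 / k < e" using e by (auto simp: k_def)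
  define W where "W = (\<lambda>y. k *\<^sub>R (y - x)) -` V \<inter> (\<lambda>y. k *\<^sub>R (x - y)) -` V"
  have "continuous_on UNIV (\<lambda>y. k *\<^sub>R (y - x))" "continuous_on UNIV (\<lambda>y. k *\<^sub>R (x - y))"
    by (auto intro!: continuous_intros continuous_on_compose2[OF continuous_on_scaleR_hausdorff_lcs])
  then have "open W" using V by (auto simp: W_def intro!: open_vimage)
  moreover have "x \<in> W" using V by (simp add: W_def)
  moreover have "f y \<in> B" if "y \<in> W" for y
  proof (rule e(2))
    have "f (k *\<^sub>R (y - x)) \<le> 1" "f (k *\<^sub>R (x - y)) \<le> 1" using that V(3) by (auto simp: W_def)
    then have "k * (f y - f x) \<le> 1" "k * (f x - f y) \<le> 1"
      by (simp_all add: linear_scale[OF f] linear_diff[OF f])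
    then have "f y - f x \<le> 1 / k" "f x - f y \<le> 1 / k" using k by (simp_all add: field_simps)
    then show "dist (f y) (f x) < e" using k(2) unfolding dist_real_def by linarith
  qed
  ultimately show "\<exists>W. open W \<and> x \<in> W \<and> (\<forall>y\<in>UNIV. y \<in> W \<longrightarrow> f y \<in> B)" by blast
qed

text \<open>Real counterpart of \<open>gauge_fun\<close>. A real \<open>Inf\<close> of the empty set
  is unspecified, so the two are compared when \<open>0 \<in> interior D\<close>.\<close>

definition real_gauge :: "'a::real_vector set \<Rightarrow> 'a \<Rightarrow> real" where
  "real_gauge D x = Inf {t. t > 0 \<and> x \<in> (*\<^sub>R) t ` D}"

text \<open>Singletons are bounded, so a neighbourhood of the origin absorbs every point.\<close>

lemma gauge_set_nonempty:
  assumes "0 \<in> interior (D :: 'a::hausdorff_lcs set)"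
  shows "{t. t > 0 \<and> x \<in> (*\<^sub>R) t ` D} \<noteq> {}"
  using tvs_bounded_singleton[of x] assms unfolding tvs_bounded_def by blast

lemma gauge_set_bdd_below: "bdd_below {t :: real. t > 0 \<and> P t}"
  by (rule bdd_belowI[of _ 0]) simp

lemma gauge_fun_eq:
  assumes "0 \<in> interior D"
  shows "gauge_fun D x = ereal (real_gauge D x)"
proof -
  have "{ereal t | t. t > 0 \<and> x \<in> (*\<^sub>R) t ` D} = ereal ` {t. t > 0 \<and> x \<in> (*\<^sub>R) t ` D}" by auto
  then show ?thesis
    unfolding gauge_fun_def real_gauge_def
    using ereal_Inf'[OF gauge_set_bdd_below gauge_set_nonempty[OF assms, of x]] by simp
qed

lemma real_gauge_le: "t > 0 \<Longrightarrow> x \<in> D \<Longrightarrow> real_gauge D (t *\<^sub>R x) \<le> t"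
  unfolding real_gauge_def by (rule cInf_lower[OF _ gauge_set_bdd_below]) auto

lemma real_gauge_le_1: "x \<in> D \<Longrightarrow> real_gauge D x \<le> 1"
  using real_gauge_le[of 1 x D] by simp

lemma sublinear_real_gauge:
  fixes D :: "'a::hausdorff_lcs set"
  assumes D: "convex D" "0 \<in> interior D"
  shows "sublinear (real_gauge D)"
  unfolding real_gauge_def
proof (rule sublinear_Inf[OF gauge_set_nonempty[OF D(2)] gauge_set_bdd_below])
  fix x y :: 'a and a b
  assume "a \<in> {t. t > 0 \<and> x \<in> (*\<^sub>R) t ` D}" "b \<in> {t. t > 0 \<and> y \<in> (*\<^sub>R) t ` D}"
  then obtain u v where uv: "a > 0" "b > 0" "u \<in> D" "v \<in> D" "x = a *\<^sub>R u" "y = b *\<^sub>R v" by auto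
  define w where "w = (a / (a + b)) *\<^sub>R u + (b / (a + b)) *\<^sub>R v"
  have "w \<in> D" unfolding w_def
    using uv by (intro convexD[OF D(1)]) (auto simp: add_divide_distrib[symmetric])
  moreover have "x + y = (a + b) *\<^sub>R w"
    using uv by (simp add: w_def scaleR_add_right)
  ultimately show "\<exists>c\<in>{t. t > 0 \<and> x + y \<in> (*\<^sub>R) t ` D}. c \<le> a + b"
    using uv by (intro bexI[of _ "a + b"]) auto
next
  fix x :: 'a and a c :: real
  assume "c > 0" "a \<in> {t. t > 0 \<and> x \<in> (*\<^sub>R) t ` D}"
  then show "c * a \<in> {t. t > 0 \<and> c *\<^sub>R x \<in> (*\<^sub>R) t ` D}" by force
qed

text \<open>A linear functional below the gauge is at most 1 on \<open>interior D\<close>, hence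
  continuous.\<close>

lemma hahn_banach_gauge:
  fixes D :: "'a::hausdorff_lcs set"
  assumes D: "convex D" "0 \<in> interior D"
  obtains f where "\<And>x. dual_apply f x \<le> real_gauge D x" "dual_apply f x\<^sub>0 = real_gauge D x\<^sub>0"
proof -
  obtain g where g: "linear g" "g \<le> real_gauge D" "g x\<^sub>0 = real_gauge D x\<^sub>0"
    using hahn_banach[OF sublinear_real_gauge[OF D]] .
  have "g v \<le> 1" if "v \<in> interior D" for v
    using le_funD[OF g(2), of v] real_gauge_le_1[of v D] interior_subset[of D] that by force
  then have "continuous_on UNIV g"
    using linear_continuous_hausdorff_lcs[OF g(1) open_interior D(2)] by blast
  then have "dual_apply (Abs_dual g) = g" using g(1) by (simp add: Abs_dual_inverse)
  then show ?thesis using that[of "Abs_dual g"] g by (simp add: le_fun_def)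
qed

text \<open>Fatten \<open>C - c\<^sub>0\<close> by a convex neighbourhood \<open>V\<close> to a set
  \<open>D\<close> that still misses \<open>x - c\<^sub>0\<close>. A functional supporting the gauge
  of \<open>D\<close> at that point separates, and the room given by \<open>V\<close> makes the
  separation strict.\<close>

lemma separate_point_closed_convex:
  fixes C :: "'a::hausdorff_lcs set"
  assumes C: "convex C" "closed C" "C \<noteq> {}" and x: "x \<notin> C"
  obtains f a where "\<And>c. c \<in> C \<Longrightarrow> dual_apply f c \<le> a" "a < dual_apply f x"
proof -
  have "open ((\<lambda>v. x - v) -` (- C))"
    using C(2) by (intro open_vimage continuous_intros) auto
  moreover have "0 \<in> (\<lambda>v. x - v) -` (- C)" using x by simp
  ultimately obtain V where V: "open V" "0 \<in> V" "V \<subseteq> (\<lambda>v. x - v) -` (- C)" "convex V"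
    by (rule locally_convex_nhd)
  obtain c\<^sub>0 where c0: "c\<^sub>0 \<in> C" using C by blast
  define D where "D = (\<Union>c\<in>(\<lambda>c. c - c\<^sub>0) ` C. \<Union>v\<in>V. {c + v})"
  have DI: "c - c\<^sub>0 + v \<in> D" if "c \<in> C" "v \<in> V" for c v using that by (auto simp: D_def)
  have D: "convex D" unfolding D_def
    using C(1) V(4) by (intro convex_sums convex_translation_subtract)
  have "V \<subseteq> D" using DI[OF c0] by auto
  then have "0 \<in> interior D" using V interiorI by blast
  then obtain f where f: "\<And>y. dual_apply f y \<le> real_gauge D y"
    "dual_apply f (x - c\<^sub>0) = real_gauge D (x - c\<^sub>0)"
    using hahn_banach_gauge[OF D] by metis
  note lin = linear_dual_apply[of f]
  have nD: "x - c\<^sub>0 \<notin> D"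
  proof
    assume "x - c\<^sub>0 \<in> D"
    then obtain c v where cv: "c \<in> C" "v \<in> V" "x - c\<^sub>0 = c - c\<^sub>0 + v" unfolding D_def by blast
    then have "x - v = c" by (simp add: algebra_simps)
    then show False using cv V(3) by blast
  qed
  \<comment> \<open>A scaling factor \<open>t < 1\<close> would make \<open>x - c\<^sub>0\<close> a
    convex combination of \<open>d\<close> and \<open>0\<close>, both in \<open>D\<close>.\<close>
  have "1 \<le> real_gauge D (x - c\<^sub>0)"
    unfolding real_gauge_def
  proof (rule cInf_greatest[OF gauge_set_nonempty[OF \<open>0 \<in> interior D\<close>]])
    fix t assume "t \<in> {t. t > 0 \<and> x - c\<^sub>0 \<in> (*\<^sub>R) t ` D}"
    then obtain d where t: "t > 0" "d \<in> D" "x - c\<^sub>0 = t *\<^sub>R d" by blast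
    show "1 \<le> t"
    proof (rule ccontr)
      assume "\<not> 1 \<le> t"
      then have "t *\<^sub>R d + (1 - t) *\<^sub>R 0 \<in> D"
        using t V(2) \<open>V \<subseteq> D\<close> by (intro convexD[OF D]) auto
      then show False using t nD by simp
    qed
  qed
  then have f1: "1 \<le> dual_apply f (x - c\<^sub>0)" using f(2) by simp
  \<comment> \<open>Some \<open>v \<in> V\<close> is a positive multiple of
    \<open>x - c\<^sub>0\<close>, so \<open>f\<close> is positive at \<open>v\<close>; this value is
    the strict gap.\<close>
  have "0 \<in> interior V" using V by (simp add: interior_open)
  then obtain s where s: "s > 0" "x - c\<^sub>0 \<in> (*\<^sub>R) s ` V"
    using gauge_set_nonempty[of V "x - c\<^sub>0"] by blast
  then obtain v where v: "v \<in> V" "x - c\<^sub>0 = s *\<^sub>R v" by blast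
  have "0 < s * dual_apply f v" using f1 v(2) by (simp add: linear_scale[OF lin])
  then have fv: "0 < dual_apply f v" using s by (simp add: zero_less_mult_iff)
  show ?thesis
  \<comment> \<open>The threshold comes from solving \<open>f (c - c\<^sub>0 + v) \<le> 1\<close>
    for \<open>f c\<close>.\<close>
  proof (rule that[of f "dual_apply f c\<^sub>0 + 1 - dual_apply f v"])
    fix c assume "c \<in> C"
    then have "dual_apply f (c - c\<^sub>0 + v) \<le> 1"
      using f(1)[of "c - c\<^sub>0 + v"] real_gauge_le_1[OF DI[OF _ v(1)]] by fastforce
    then show "dual_apply f c \<le> dual_apply f c\<^sub>0 + 1 - dual_apply f v"
      by (simp add: linear_add[OF lin] linear_diff[OF lin])
  next
    show "dual_apply f c\<^sub>0 + 1 - dual_apply f v < dual_apply f x"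
      using f1 fv by (simp add: linear_diff[OF lin])
  qed
qed

section \<open>The minimal time function\<close>

text \<open>Hitting \<open>\<Omega>\<close> at time \<open>t\<close> means
  \<open>\<omega> - x \<in> t F\<close> for some \<open>\<omega>\<close>, so both sides are one
  infimum over pairs of \<open>\<omega>\<close> and \<open>t\<close>.\<close>

lemma minimal_time_eq_INF: "minimal_time F \<Omega> x = (INF \<omega>\<in>\<Omega>. gauge_fun F (\<omega> - x))"
proof (rule antisym)
  have "minimal_time F \<Omega> x \<le> ereal t" if "\<omega> \<in> \<Omega>" "t > 0" "\<omega> - x \<in> (*\<^sub>R) t ` F" for \<omega> t
  proof -
    have "\<omega> \<in> (+) x ` (*\<^sub>R) t ` F" using that(3) by (intro image_eqI[of \<omega> _ "\<omega> - x"]) simp_all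
    then show ?thesis using that unfolding minimal_time_def by (intro Inf_lower) blast
  qed
  then show "minimal_time F \<Omega> x \<le> (INF \<omega>\<in>\<Omega>. gauge_fun F (\<omega> - x))"
    unfolding gauge_fun_def by (intro INF_greatest Inf_greatest) blast
  have "(INF \<omega>\<in>\<Omega>. gauge_fun F (\<omega> - x)) \<le> ereal t"
    if t: "t > 0" "((+) x ` (*\<^sub>R) t ` F) \<inter> \<Omega> \<noteq> {}" for t
  proof -
    obtain y where y: "y \<in> F" "x + t *\<^sub>R y \<in> \<Omega>" using t(2) by blast
    then have "gauge_fun F (x + t *\<^sub>R y - x) \<le> ereal t"
      using t(1) unfolding gauge_fun_def by (intro Inf_lower) auto
    then show ?thesis using y(2) by (rule INF_lower2[rotated])
  qed
  then show "(INF \<omega>\<in>\<Omega>. gauge_fun F (\<omega> - x)) \<le> minimal_time F \<Omega> x"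
    unfolding minimal_time_def by (intro Inf_greatest) blast
qed

text \<open>Nonnegativity of the gauge keeps the infimum finite. The last two properties are the two
  halves of being a greatest lower bound.\<close>

lemma minimal_time_real:
  assumes F: "0 \<in> interior F" and "\<Omega> \<noteq> {}"
  obtains \<tau> where "\<And>x. minimal_time F \<Omega> x = ereal (\<tau> x)"
    "\<And>x \<omega>. \<omega> \<in> \<Omega> \<Longrightarrow> \<tau> x \<le> real_gauge F (\<omega> - x)"
    "\<And>x a. (\<And>\<omega>. \<omega> \<in> \<Omega> \<Longrightarrow> a \<le> real_gauge F (\<omega> - x)) \<Longrightarrow> a \<le> \<tau> x"
proof
  let ?\<tau> = "\<lambda>x. INF \<omega>\<in>\<Omega>. real_gauge F (\<omega> - x)"
  have "0 \<le> real_gauge F y" for y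
    unfolding real_gauge_def by (rule cInf_greatest[OF gauge_set_nonempty[OF F]]) simp
  then have bdd: "bdd_below ((\<lambda>\<omega>. real_gauge F (\<omega> - x)) ` \<Omega>)" for x
    by (intro bdd_belowI2[of _ 0])
  show "minimal_time F \<Omega> x = ereal (?\<tau> x)" for x
    using ereal_Inf'[OF bdd[of x]] assms(2)
    by (simp add: minimal_time_eq_INF gauge_fun_eq[OF F] image_comp comp_def)
  show "?\<tau> x \<le> real_gauge F (\<omega> - x)" if "\<omega> \<in> \<Omega>" for x \<omega>
    using bdd that by (rule cINF_lower)
  show "a \<le> ?\<tau> x" if "\<And>\<omega>. \<omega> \<in> \<Omega> \<Longrightarrow> a \<le> real_gauge F (\<omega> - x)" for x a
    using assms(2) that by (rule cINF_greatest)
qed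

section \<open>Existence of a projection\<close>

lemma generalized_projection_nonempty:
  fixes F \<Omega> :: "'a::hausdorff_lcs set"
  assumes refl: "semi_reflexive TYPE('a)"
    and F: "convex F" "0 \<in> interior F"
    and \<Omega>: "\<Omega> \<noteq> {}" "convex \<Omega>" "closed \<Omega>" "tvs_bounded \<Omega>"
  shows "generalized_projection F x \<Omega> \<noteq> {}"
proof -
  let ?p = "real_gauge F"
  obtain \<tau> where \<tau>: "\<And>x. minimal_time F \<Omega> x = ereal (\<tau> x)"
    "\<And>x \<omega>. \<omega> \<in> \<Omega> \<Longrightarrow> \<tau> x \<le> ?p (\<omega> - x)"
    "\<And>x a. (\<And>\<omega>. \<omega> \<in> \<Omega> \<Longrightarrow> a \<le> ?p (\<omega> - x)) \<Longrightarrow> a \<le> \<tau> x"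
    using minimal_time_real[OF F(2) \<Omega>(1)] by blast
  define C where "C t = {\<omega> \<in> \<Omega>. ?p (\<omega> - x) \<le> t}" for t
  have Cne: "C t \<noteq> {}" if "t > \<tau> x" for t
    using \<tau>(3)[of t x] that unfolding C_def by force
  \<comment> \<open>\<open>A f\<close> collects the upper bounds of \<open>f\<close> on sublevel
    sets strictly above the infimum, where \<open>C t\<close> is known to be nonempty;
    \<open>Inf (A f)\<close> is the functional \<open>q(f)\<close>.\<close>
  define A where "A f = {a. \<exists>t>\<tau> x. \<forall>\<omega>\<in>C t. dual_apply f \<omega> \<le> a}" for f
  have AI: "a \<in> A f" if "\<And>\<omega>. \<omega> \<in> \<Omega> \<Longrightarrow> dual_apply f \<omega> \<le> a" for a f
    using that unfolding A_def C_def by (auto intro!: exI[of _ "\<tau> x + 1"])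
  have bdd: "bdd_below (A f)" for f
  proof -
    obtain M where M: "\<And>\<omega>. \<omega> \<in> \<Omega> \<Longrightarrow> \<bar>dual_apply f \<omega>\<bar> < M" using dual_bounded_on[OF \<Omega>(4)] by blast
    show ?thesis
    proof (rule bdd_belowI[of _ "- M"])
      fix a assume "a \<in> A f"
      then obtain t where "t > \<tau> x" "\<And>\<omega>. \<omega> \<in> C t \<Longrightarrow> dual_apply f \<omega> \<le> a" by (auto simp: A_def)
      then obtain \<omega> where "\<omega> \<in> \<Omega>" "dual_apply f \<omega> \<le> a" using Cne unfolding C_def by blast
      then show "- M \<le> a" using M[of \<omega>] by linarith
    qed
  qed
  have "sublinear (\<lambda>f. Inf (A f))"
  proof (rule sublinear_Inf[OF _ bdd])
    show "A f \<noteq> {}" for f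
    proof -
      obtain M where "\<And>\<omega>. \<omega> \<in> \<Omega> \<Longrightarrow> \<bar>dual_apply f \<omega>\<bar> < M" using dual_bounded_on[OF \<Omega>(4)] by blast
      then have "M \<in> A f" by (intro AI) force
      then show ?thesis by blast
    qed
    show "\<exists>c\<in>A (f + g). c \<le> a + b" if ab: "a \<in> A f" "b \<in> A g" for f g a b
    proof -
      obtain s t where st: "s > \<tau> x" "\<And>\<omega>. \<omega> \<in> C s \<Longrightarrow> dual_apply f \<omega> \<le> a"
        "t > \<tau> x" "\<And>\<omega>. \<omega> \<in> C t \<Longrightarrow> dual_apply g \<omega> \<le> b" using ab by (auto simp: A_def)
      \<comment> \<open>The sublevel sets are nested, so both bounds hold on the smaller
        one.\<close>
      have "C (min s t) \<subseteq> C s \<inter> C t" by (auto simp: C_def)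
      then have "\<forall>\<omega>\<in>C (min s t). dual_apply (f + g) \<omega> \<le> a + b"
        using st by (auto intro!: add_mono)
      moreover have "min s t > \<tau> x" using st by simp
      ultimately have "a + b \<in> A (f + g)" unfolding A_def by blast
      then show ?thesis by blast
    qed
    show "c * a \<in> A (c *\<^sub>R f)" if "c > 0" "a \<in> A f" for f a c
      using that by (force simp: A_def)
  qed
  then obtain \<Phi> where \<Phi>: "linear \<Phi>" "\<Phi> \<le> (\<lambda>f. Inf (A f))" using hahn_banach by blast
  have \<Phi>A: "\<Phi> f \<le> a" if "a \<in> A f" for f a
    using le_funD[OF \<Phi>(2), of f] cInf_lower[OF that bdd] by simp
  \<comment> \<open>As \<open>\<Omega>\<close> is bounded, \<open>dual_nhd 0 \<Omega> 1\<close> is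
    strongly open, and its members have 1 as an upper bound on \<open>\<Omega>\<close>.\<close>
  have "continuous_on UNIV \<Phi>"
  proof (rule linear_continuous_hausdorff_lcs[OF \<Phi>(1)])
    show "open (dual_nhd 0 \<Omega> 1)" using \<Omega>(4) by (rule open_dual_nhd)
    show "0 \<in> dual_nhd 0 \<Omega> 1" by (rule dual_nhd_self) simp
    show "\<Phi> f \<le> 1" if "f \<in> dual_nhd 0 \<Omega> 1" for f
      by (intro \<Phi>A AI) (use dual_nhdD[OF that] in force)
  qed
  then have \<Phi>_dual: "dual_apply (Abs_dual \<Phi>) = \<Phi>" using \<Phi>(1) by (simp add: Abs_dual_inverse)
  obtain w where "Abs_dual \<Phi> = bidual_embedding w"
    using refl unfolding semi_reflexive_def by (metis surjD)
  then have w: "\<Phi> f = dual_apply f w" for f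
    using \<Phi>_dual bidual_embedding.rep_eq[of w] by metis
  \<comment> \<open>Any bound \<open>a\<close> of \<open>f\<close> on \<open>\<Omega>\<close> lies
    in \<open>A f\<close>, so \<open>f w = \<Phi> f \<le> a\<close>, which contradicts strict
    separation.\<close>
  have "w \<in> \<Omega>"
  proof (rule ccontr)
    assume "w \<notin> \<Omega>"
    then obtain f a where "\<And>\<omega>. \<omega> \<in> \<Omega> \<Longrightarrow> dual_apply f \<omega> \<le> a" "a < dual_apply f w"
      using separate_point_closed_convex \<Omega> by metis
    then show False using \<Phi>A[OF AI] w by force
  qed
  moreover have "?p (w - x) \<le> \<tau> x"
  proof (rule field_le_epsilon)
    fix e :: real assume "e > 0"
    obtain f where f: "\<And>y. dual_apply f y \<le> ?p y" "dual_apply f (w - x) = ?p (w - x)"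
      using hahn_banach_gauge[OF F] by metis
    note diff = linear_diff[OF linear_dual_apply[of f]]
    \<comment> \<open>Domination by the gauge bounds \<open>f\<close> on
      \<open>C (\<tau> x + e)\<close>; the bound passes to \<open>w\<close> through
      \<open>\<Phi>\<close>.\<close>
    have "dual_apply f \<omega> \<le> dual_apply f x + (\<tau> x + e)" if "\<omega> \<in> C (\<tau> x + e)" for \<omega>
      using f(1)[of "\<omega> - x"] that by (simp add: C_def diff)
    then have "dual_apply f w \<le> dual_apply f x + (\<tau> x + e)"
      using \<open>e > 0\<close> unfolding w[symmetric] by (intro \<Phi>A) (auto simp: A_def intro!: exI[of _ "\<tau> x + e"])
    then show "?p (w - x) \<le> \<tau> x + e" using f(2) by (simp add: diff)
  qed
  ultimately have "w \<in> generalized_projection F x \<Omega>"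
    using \<tau>(2)[of w x] by (simp add: generalized_projection_def \<tau>(1) gauge_fun_eq[OF F(2)])
  then show ?thesis by blast
qed

section \<open>The subdifferential formula\<close>

lemma subdifferential_ereal:
  assumes "\<And>x. \<phi> x = ereal (g x)"
  shows "subdifferential \<phi> a = {f. \<forall>x. dual_apply f (x - a) \<le> g x - g a}"
  by (simp add: subdifferential_def assms)

lemma subdifferential_minimal_time:
  assumes F: "0 \<in> interior F" and w: "w \<in> generalized_projection F x \<Omega>"
  shows "subdifferential (minimal_time F \<Omega>) x =
    uminus ` subdifferential (gauge_fun F) (w - x) \<inter> normal_cone w \<Omega>" (is "?L = ?R")
proof -
  let ?p = "real_gauge F"
  have w\<Omega>: "w \<in> \<Omega>" using w by (simp add: generalized_projection_def)
  obtain \<tau> where \<tau>: "\<And>x. minimal_time F \<Omega> x = ereal (\<tau> x)"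
    "\<And>x \<omega>. \<omega> \<in> \<Omega> \<Longrightarrow> \<tau> x \<le> ?p (\<omega> - x)"
    "\<And>x a. (\<And>\<omega>. \<omega> \<in> \<Omega> \<Longrightarrow> a \<le> ?p (\<omega> - x)) \<Longrightarrow> a \<le> \<tau> x"
    using minimal_time_real[OF F, of \<Omega>] w\<Omega> by blast
  have eq: "\<tau> x = ?p (w - x)"
    using w by (simp add: generalized_projection_def \<tau>(1) gauge_fun_eq[OF F])
  have L: "f \<in> ?L \<longleftrightarrow> (\<forall>y. dual_apply f (y - x) \<le> \<tau> y - \<tau> x)" for f
    by (simp add: subdifferential_ereal[of "minimal_time F \<Omega>" \<tau>, OF \<tau>(1)])
  have "f \<in> uminus ` S \<longleftrightarrow> - f \<in> S" for f :: "'a dual" and S by force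
  then have R: "f \<in> ?R \<longleftrightarrow> (\<forall>y. - dual_apply f (y - (w - x)) \<le> ?p y - ?p (w - x)) \<and>
      (\<forall>\<omega>\<in>\<Omega>. dual_apply f (\<omega> - w) \<le> 0)" for f
    by (simp add: subdifferential_ereal[of "gauge_fun F" ?p, OF gauge_fun_eq[OF F]]
        normal_cone_def)
  have "f \<in> ?L \<longleftrightarrow> f \<in> ?R" for f
  proof
    note lin = linear_add[OF linear_dual_apply[of f]] linear_diff[OF linear_dual_apply[of f]]
    assume "f \<in> ?L"
    then have f: "dual_apply f (y - x) \<le> \<tau> y - \<tau> x" for y using L by blast
    \<comment> \<open>At \<open>w - y\<close> the minimal time is at most \<open>?p y\<close>,
      because \<open>w\<close> is a competitor.\<close>
    have "- dual_apply f (y - (w - x)) \<le> ?p y - ?p (w - x)" for y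
      using f[of "w - y"] \<tau>(2)[OF w\<Omega>, of "w - y"] eq by (simp add: lin)
    \<comment> \<open>Moving \<open>x\<close> by \<open>\<omega> - w\<close> makes
      \<open>\<omega>\<close> a competitor with gauge value \<open>?p (w - x)\<close>, so the
      minimal time does not increase.\<close>
    moreover have "dual_apply f (\<omega> - w) \<le> 0" if "\<omega> \<in> \<Omega>" for \<omega>
      using f[of "x + \<omega> - w"] \<tau>(2)[OF that, of "x + \<omega> - w"] eq by (simp add: lin)
    ultimately show "f \<in> ?R" using R by blast
  next
    note lin = linear_add[OF linear_dual_apply[of f]] linear_diff[OF linear_dual_apply[of f]]
    assume "f \<in> ?R"
    then have f: "- dual_apply f (y - (w - x)) \<le> ?p y - ?p (w - x)"
      "\<omega> \<in> \<Omega> \<Longrightarrow> dual_apply f (\<omega> - w) \<le> 0" for y \<omega> using R by blast+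
    \<comment> \<open>Split \<open>y - x\<close> as
      \<open>(\<omega> - w) - ((\<omega> - y) - (w - x))\<close>: the normal cone controls the first
      term, the gauge subgradient the second.\<close>
    have "\<tau> x + dual_apply f (y - x) \<le> \<tau> y" for y
    proof (rule \<tau>(3))
      fix \<omega> assume "\<omega> \<in> \<Omega>"
      then show "\<tau> x + dual_apply f (y - x) \<le> ?p (\<omega> - y)"
        using f(1)[of "\<omega> - y"] f(2)[of \<omega>] eq by (simp add: lin)
    qed
    then show "f \<in> ?L" unfolding L by (smt (verit))
  qed
  then show ?thesis by blast
qed

theorem theorem4p6:
  fixes F \<Omega> :: "'a::hausdorff_lcs set" and xbar :: 'a
  assumes "semi_reflexive TYPE('a)"
    and "convex F" and "0 \<in> interior F"
    and "\<Omega> \<noteq> {}" and "convex \<Omega>" and "closed \<Omega>" and "tvs_bounded \<Omega>"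
  shows "generalized_projection F xbar \<Omega> \<noteq> {} \<and>
    (\<forall>\<omega>bar \<in> generalized_projection F xbar \<Omega>.
      subdifferential (minimal_time F \<Omega>) xbar =
        uminus ` subdifferential (gauge_fun F) (\<omega>bar - xbar) \<inter> normal_cone \<omega>bar \<Omega>)"
  using generalized_projection_nonempty[OF assms] subdifferential_minimal_time[OF assms(3)]
  by blast

end
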